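(* For each $n\ge1$, the map $\phi$ (defined in the context) is a bijection from the set of node-marked Klazar trees with $n$ edges to the set of $n$-edge increasing ordered trees, and for each node-marked Klazar tree $T$ the marked nodes of $T$ are precisely the Klazar violators of $\phi(T)$. Consequently the number of node-marked Klazar trees with $n$ edges is $(2n-1)!!$, i.e. $\sum_{K}2^{\nu(K)}=(2n-1)!!$, where the sum is over all Klazar trees $K$ with $n$ edges and $\nu(K)$ is the number of nodes of $K$.
   Context: An $n$-edge increasing ordered tree is a rooted ordered (plane) tree with vertices labeled bijectively by $0,1,\dots,n$ so that each child's label exceeds its parent's; vertices are identified with labels. The cohort of a vertex $v$ is the left-to-right list of its siblings strictly to its left; the big cohort of $v$ is the maximal terminal (rightmost) sublist of its cohort all of whose entries exceed $v$. A vertex $v$ is a descent terminator if its big cohort is nonempty, and then its associate is the smallest entry of its big cohort. A Klazar violator is a descent terminator $v$ whose associate is smaller than every child of $v$ (vacuously true for a leaf). A Klazar tree is an increasing ordered tree with no Klazar violators. A node of a rooted tree is a vertex that is neither the root nor a leaf. A node-marked Klazar tree is a Klazar tree in which some (possibly all or none) of its nodes are marked. Definition of $\phi$: process the marked nodes one after the other (the order is immaterial). To process a marked node $u$, let $v$ be the smallest child of $u$; take $v$ and its cohort and transfer all these vertices, along with their subtrees and in the same order, so that they become siblings of $u$ situated immediately to the left of the big cohort of $u$; then remove the mark from $u$. $\phi(T)$ is the resulting tree after all marked nodes are processed. *)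

theory Defs
  imports Main
begin

text \<open>
  Vertices are identified with their labels, so an ordered tree is given by the function that maps
  each vertex to the left-to-right list of its children. Outside the vertex set the function is
  \<^term>\<open>[]\<close>, so that equality of functions is equality of trees.
\<close>

type_synonym 'a plane_tree = "'a \<Rightarrow> 'a list"

definition child_rel :: "'a plane_tree \<Rightarrow> ('a \<times> 'a) set" where
  "child_rel T = {(v, w). w \<in> set (T v)}"

definition rooted_ordered_tree :: "'a set \<Rightarrow> 'a \<Rightarrow> 'a plane_tree \<Rightarrow> bool" where
  "rooted_ordered_tree V r T \<longleftrightarrow>
     r \<in> V \<and>
     (\<forall>v. v \<notin> V \<longrightarrow> T v = []) \<and>
     (\<forall>v\<in>V. set (T v) \<subseteq> V - {r} \<and> distinct (T v)) \<and>
     (\<forall>w\<in>V - {r}. \<exists>!v. w \<in> set (T v)) \<and>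
     (\<forall>w\<in>V. (r, w) \<in> (child_rel T)\<^sup>*)"

definition increasing_ordered_trees :: "nat \<Rightarrow> nat plane_tree set" where
  "increasing_ordered_trees n =
     {T. (\<exists>r. rooted_ordered_tree {0..n} r T) \<and> (\<forall>v. \<forall>w\<in>set (T v). v < w)}"

definition has_parent :: "'a plane_tree \<Rightarrow> 'a \<Rightarrow> bool" where
  "has_parent T v \<longleftrightarrow> (\<exists>p. v \<in> set (T p))"

definition parent :: "'a plane_tree \<Rightarrow> 'a \<Rightarrow> 'a" where
  "parent T v = (THE p. v \<in> set (T p))"

definition cohort :: "'a plane_tree \<Rightarrow> 'a \<Rightarrow> 'a list" where
  "cohort T v = (if has_parent T v then takeWhile (\<lambda>x. x \<noteq> v) (T (parent T v)) else [])"

definition big_cohort :: "nat plane_tree \<Rightarrow> nat \<Rightarrow> nat list" where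
  "big_cohort T v = rev (takeWhile (\<lambda>x. v < x) (rev (cohort T v)))"

definition descent_terminator :: "nat plane_tree \<Rightarrow> nat \<Rightarrow> bool" where
  "descent_terminator T v \<longleftrightarrow> big_cohort T v \<noteq> []"

definition associate :: "nat plane_tree \<Rightarrow> nat \<Rightarrow> nat" where
  "associate T v = Min (set (big_cohort T v))"

definition Klazar_violator :: "nat plane_tree \<Rightarrow> nat \<Rightarrow> bool" where
  "Klazar_violator T v \<longleftrightarrow>
     descent_terminator T v \<and> (\<forall>c\<in>set (T v). associate T v < c)"

definition Klazar_trees :: "nat \<Rightarrow> nat plane_tree set" where
  "Klazar_trees n = {T \<in> increasing_ordered_trees n. \<not> (\<exists>v. Klazar_violator T v)}"

text \<open>The vertices without a parent in a tree are exactly the root.\<close>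

definition nodes :: "'a plane_tree \<Rightarrow> 'a set" where
  "nodes T = {v. has_parent T v \<and> T v \<noteq> []}"

text \<open>A node-marked tree is a pair of a tree and its set of marked nodes.\<close>

definition node_marked_Klazar_trees :: "nat \<Rightarrow> (nat plane_tree \<times> nat set) set" where
  "node_marked_Klazar_trees n = {(T, M). T \<in> Klazar_trees n \<and> M \<subseteq> nodes T}"

text \<open>
  Subtrees move along with their roots automatically, since only the two child lists of
  \<^term>\<open>u\<close> and its parent change.
\<close>

definition process :: "nat \<Rightarrow> nat plane_tree \<Rightarrow> nat plane_tree" where
  "process u T =
     (let p = parent T u;
          v = Min (set (T u));
          moved = cohort T v @ [v];
          kept = drop (length moved) (T u);
          left = take (length (cohort T u) - length (big_cohort T u)) (cohort T u);
          right = drop (length (cohort T u)) (T p)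
      in T(p := left @ moved @ big_cohort T u @ right, u := kept))"

text \<open>
  Increasing order is an arbitrary choice: on node-marked Klazar trees every order of processing
  the marked nodes gives the same result.
\<close>

definition phi :: "nat plane_tree \<times> nat set \<Rightarrow> nat plane_tree" where
  "phi = (\<lambda>(T, M). fold process (sorted_list_of_set M) T)"

fun double_fact :: "nat \<Rightarrow> nat" where
  "double_fact 0 = 1"
| "double_fact (Suc 0) = 1"
| "double_fact (Suc (Suc n)) = Suc (Suc n) * double_fact n"

end

theory Submission
  imports Defs
begin

text \<open>
  A list of distinct numbers is the same thing as an increasing binary tree: its root is the minimum,
  and the parts of the list before and after the minimum give the two subtrees. In the binary tree
  of a sibling list, the subtrees of a vertex \<open>u\<close> are the maximal runs of larger siblings next to
  \<open>u\<close>; the left one is the big cohort of \<open>u\<close>, and its root is the associate of \<open>u\<close>. Hence an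
  increasing ordered tree amounts to three partial maps on vertices: \<open>left_link\<close> (the associate),
  \<open>right_link\<close> (the minimum of the run to the right) and \<open>down_link\<close> (the smallest child). The links
  determine the tree (\<open>links_determine_tree\<close>), and \<open>u\<close> is a Klazar violator iff its left link exists
  and is smaller than its down link, if there is one (\<open>Klazar_violator_iff_links\<close>).

  Let \<open>u\<close> be a node that is not a violator, with smallest child \<open>v\<close>. Processing \<open>u\<close> rotates
  three links and changes no other (\<open>left_link_T'\<close>, \<open>right_link_T'\<close>, \<open>down_link_T'\<close>):
  the left link of \<open>u\<close> becomes \<open>v\<close>, the down link of \<open>u\<close> becomes the old right link of \<open>v\<close>, and
  the right link of \<open>v\<close> becomes the old left link of \<open>u\<close>. As the right link
  of \<open>v\<close> exceeds \<open>v\<close>, this makes \<open>u\<close> a violator; the status of all other vertices is unchanged. Conversely every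
  violator arises from such a step (\<open>violator_transfer\<close>).

  Different marked nodes have different smallest children, so their steps rotate disjoint triples
  of links. The links after processing a whole set of marked nodes therefore have a closed form
  (\<open>fold_process\<close>), from which both the independence of the order (\<open>fold_process_order\<close>) and
  the injectivity of \<open>phi\<close> (\<open>fold_process_inj\<close>) can be read off. Undoing the violators one by one
  leads to a Klazar tree, which gives surjectivity (\<open>fold_process_surj\<close>). The number
  \<open>(2n-1)!!\<close> comes from building increasing ordered trees by adding the largest label as a leaf: a tree
  with \<open>n\<close> edges has \<open>2n+1\<close> places for it (\<open>bij_insert_leaf\<close>).
\<close>

section \<open>Increasing ordered trees\<close>

text \<open>
  The root must be \<open>0\<close>, as \<open>0\<close> cannot be a child. Following parents strictly decreases the label,
  so every vertex is reached from \<open>0\<close>; this makes reachability and the bounds on the vertex set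
  consequences of the local conditions on the right.
\<close>

lemma increasing_ordered_trees_iff:
  "T \<in> increasing_ordered_trees n \<longleftrightarrow>
     (\<forall>v. distinct (T v) \<and> set (T v) \<subseteq> {v<..n}) \<and> (\<forall>w\<in>{0<..n}. \<exists>!v. w \<in> set (T v))"
  (is "?L \<longleftrightarrow> ?R")
proof
  assume ?L
  then obtain r where T: "rooted_ordered_tree {0..n} r T" and lt: "\<And>v w. w \<in> set (T v) \<Longrightarrow> v < w"
    unfolding increasing_ordered_trees_def by blast
  have "r = 0"
  proof (rule ccontr)
    assume "r \<noteq> 0"
    then have "0 \<in> {0..n} - {r}" by auto
    then obtain v where "0 \<in> set (T v)" using T unfolding rooted_ordered_tree_def by blast
    then show False using lt by blast
  qed
  show ?R
  proof (intro conjI allI ballI)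
    fix v
    show "distinct (T v)" "set (T v) \<subseteq> {v<..n}"
      using T lt[of _ v] unfolding rooted_ordered_tree_def by (cases "v \<in> {0..n}"; fastforce)+
  next
    fix w assume "w \<in> {0<..n}"
    then have "w \<in> {0..n} - {r}" using \<open>r = 0\<close> by auto
    then show "\<exists>!v. w \<in> set (T v)" using T unfolding rooted_ordered_tree_def by blast
  qed
next
  assume R: ?R
  have reach: "w \<le> n \<Longrightarrow> (0, w) \<in> (child_rel T)\<^sup>*" for w
  proof (induction w rule: less_induct)
    case (less w)
    show ?case
    proof (cases "w = 0")
      case False
      then obtain v where v: "w \<in> set (T v)" using R less.prems by force
      then have "v < w" "v \<le> n" using R less.prems by fastforce+
      then have "(0, v) \<in> (child_rel T)\<^sup>*" using less.IH by blast
      moreover have "(v, w) \<in> child_rel T" using v by (simp add: child_rel_def)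
      ultimately show ?thesis by (rule rtrancl_into_rtrancl)
    qed simp
  qed
  have "T v = []" if "v \<notin> {0..n}" for v
  proof -
    have "set (T v) \<subseteq> {v<..n}" using R by blast
    then show ?thesis using that by auto
  qed
  moreover have "set (T v) \<subseteq> {0..n} - {0}" for v
  proof -
    have "set (T v) \<subseteq> {v<..n}" using R by blast
    then show ?thesis by auto
  qed
  moreover have "\<exists>!v. w \<in> set (T v)" if "w \<in> {0..n} - {0}" for w
    using R that by auto
  ultimately have "rooted_ordered_tree {0..n} 0 T"
    using R reach unfolding rooted_ordered_tree_def by auto
  moreover have "\<forall>v. \<forall>w\<in>set (T v). v < w" using R by fastforce
  ultimately show ?L unfolding increasing_ordered_trees_def by blast
qed

lemma child_bounds:
  assumes "T \<in> increasing_ordered_trees n" "w \<in> set (T v)"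
  shows "v < w" "w \<le> n"
  using assms unfolding increasing_ordered_trees_iff by fastforce+

lemma distinct_children: "T \<in> increasing_ordered_trees n \<Longrightarrow> distinct (T v)"
  unfolding increasing_ordered_trees_iff by blast

lemma parent_unique:
  assumes "T \<in> increasing_ordered_trees n" "w \<in> set (T p)" "w \<in> set (T q)"
  shows "p = q"
proof -
  have "w \<in> {0<..n}" using child_bounds[OF assms(1,2)] by auto
  then show ?thesis using assms unfolding increasing_ordered_trees_iff by blast
qed

lemma parent_eq:
  assumes "T \<in> increasing_ordered_trees n" "w \<in> set (T p)"
  shows "parent T w = p"
  unfolding parent_def using assms parent_unique by blast

lemma has_parent_iff:
  assumes "T \<in> increasing_ordered_trees n"
  shows "has_parent T w \<longleftrightarrow> w \<in> {0<..n}"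
proof
  assume "has_parent T w"
  then obtain p where "w \<in> set (T p)" unfolding has_parent_def by blast
  then show "w \<in> {0<..n}" using child_bounds[OF assms] by fastforce
next
  assume "w \<in> {0<..n}"
  then show "has_parent T w" using assms unfolding increasing_ordered_trees_iff has_parent_def by blast
qed

definition later_siblings :: "'a plane_tree \<Rightarrow> 'a \<Rightarrow> 'a list" where
  "later_siblings T v = (if has_parent T v then tl (dropWhile (\<lambda>x. x \<noteq> v) (T (parent T v))) else [])"

lemma siblings_split:
  assumes "T \<in> increasing_ordered_trees n" "T p = P @ w # Q"
  shows "cohort T w = P" "later_siblings T w = Q"
proof -
  have w: "w \<in> set (T p)" using assms(2) by simp
  have "w \<notin> set P" using distinct_children[OF assms(1), of p] assms(2) by simp
  moreover have "has_parent T w" using w unfolding has_parent_def by blast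
  ultimately show "cohort T w = P" "later_siblings T w = Q"
    using parent_eq[OF assms(1) w] assms(2)
    by (auto simp: cohort_def later_siblings_def takeWhile_append dropWhile_append)
qed

lemma no_siblings:
  assumes "\<not> has_parent T w"
  shows "cohort T w = []" "later_siblings T w = []"
  using assms by (auto simp: cohort_def later_siblings_def)

section \<open>Links\<close>

text \<open>
  The list runs away from \<open>w\<close>: it is the reversed cohort of \<open>w\<close>, its later siblings, or the list
  of its children, which all exceed \<open>w\<close>. Then \<open>low\<close> is the root of the corresponding
  subtree of \<open>w\<close>.
\<close>

definition low :: "nat \<Rightarrow> nat list \<Rightarrow> nat option" where
  "low w xs = (let ys = takeWhile (\<lambda>x. w < x) xs in if ys = [] then None else Some (Min (set ys)))"

lemma low_stop:
  assumes "Q = [] \<or> hd Q < w"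
  shows "low w (P @ Q) = low w P"
proof -
  have "takeWhile (\<lambda>x. w < x) Q = []" using assms by (cases Q) auto
  then have "takeWhile (\<lambda>x. w < x) (P @ Q) = takeWhile (\<lambda>x. w < x) P"
    by (cases "\<forall>x\<in>set P. w < x") (simp_all add: takeWhile_append takeWhile_eq_all_conv[THEN iffD2])
  then show ?thesis by (simp add: low_def)
qed

lemma low_cut:
  assumes "\<exists>x\<in>set P. x < w"
  shows "low w (P @ Q) = low w P"
proof -
  have "\<not> (\<forall>x\<in>set P. w < x)" using assms by fastforce
  then show ?thesis by (simp only: low_def takeWhile_append if_False)
qed

text \<open>
  A block \<open>M\<close> of entries larger than \<open>u\<close> cannot affect \<open>low w\<close> if the entries \<open>B\<close> between \<open>u\<close> and
  \<open>M\<close> also exceed \<open>u\<close>: either the scan stops in \<open>P\<close>, or it runs over \<open>M\<close>, \<open>B\<close> and \<open>u\<close>, and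
  \<open>u\<close> beats all of \<open>M\<close>. The two forms scan towards \<open>u\<close> from the left and from the right.
\<close>

lemma low_remove:
  assumes "w < u" "\<forall>x\<in>set M. u < x" "\<forall>x\<in>set B. u < x"
  shows "low w (P @ M @ B @ u # R) = low w (P @ B @ u # R)"
    and "low w (P @ u # B @ M @ R) = low w (P @ u # B @ R)"
proof -
  have M: "\<forall>x\<in>set M. w < x" and B: "\<forall>x\<in>set B. w < x" using assms by auto
  let ?t = "takeWhile (\<lambda>x. w < x)"
  have *: "Min (set M \<union> S) = Min S" if "finite S" "u \<in> S" for S
  proof (rule antisym)
    show "Min (set M \<union> S) \<le> Min S" using that by (intro Min_antimono) auto
    show "Min S \<le> Min (set M \<union> S)"
    proof (rule Min.boundedI)
      fix a assume "a \<in> set M \<union> S"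
      then show "Min S \<le> a"
        using assms(2) Min_le[OF that] Min_le[OF that(1), of a]
        by (metis Un_iff less_imp_le order_trans)
    qed (use that in auto)
  qed
  show "low w (P @ M @ B @ u # R) = low w (P @ B @ u # R)"
  proof (cases "\<forall>x\<in>set P. w < x")
    case True
    have "?t (P @ M @ B @ u # R) = P @ M @ B @ u # ?t R" "?t (P @ B @ u # R) = P @ B @ u # ?t R"
      using True M B assms(1) by (simp_all add: takeWhile_append takeWhile_eq_all_conv[THEN iffD2])
    moreover have "Min (set M \<union> set (P @ B @ u # ?t R)) = Min (set (P @ B @ u # ?t R))"
      by (rule *) auto
    ultimately show ?thesis by (simp add: low_def Let_def insert_commute Un_commute Un_left_commute)
  next
    case False
    then show ?thesis by (simp only: low_def takeWhile_append if_False)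
  qed
  show "low w (P @ u # B @ M @ R) = low w (P @ u # B @ R)"
  proof (cases "\<forall>x\<in>set P. w < x")
    case True
    have "?t (P @ u # B @ M @ R) = P @ u # B @ M @ ?t R" "?t (P @ u # B @ R) = P @ u # B @ ?t R"
      using True M B assms(1) by (simp_all add: takeWhile_append takeWhile_eq_all_conv[THEN iffD2])
    moreover have "Min (set M \<union> set (P @ u # B @ ?t R)) = Min (set (P @ u # B @ ?t R))"
      by (rule *) auto
    ultimately show ?thesis by (simp add: low_def Let_def insert_commute Un_commute Un_left_commute)
  next
    case False
    then show ?thesis by (simp only: low_def takeWhile_append if_False)
  qed
qed

lemma low_all:
  assumes "\<forall>x\<in>set xs. w < x"
  shows "low w xs = (if xs = [] then None else Some (Min (set xs)))"
proof -
  have "takeWhile (\<lambda>x. w < x) xs = xs" using assms by (simp add: takeWhile_eq_all_conv)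
  then show ?thesis by (simp only: low_def Let_def)
qed

lemma low_SomeD:
  assumes "low w xs = Some a"
  shows "w < a" "a \<in> set xs"
proof -
  let ?ys = "takeWhile (\<lambda>x. w < x) xs"
  have "?ys \<noteq> []" "a = Min (set ?ys)" using assms by (auto simp: low_def Let_def split: if_splits)
  then have "a \<in> set ?ys" by simp
  then show "w < a" "a \<in> set xs" by (auto dest: set_takeWhileD)
qed

definition left_link :: "nat plane_tree \<Rightarrow> nat \<Rightarrow> nat option" where
  "left_link T w = low w (rev (cohort T w))"

definition right_link :: "nat plane_tree \<Rightarrow> nat \<Rightarrow> nat option" where
  "right_link T w = low w (later_siblings T w)"

definition down_link :: "nat plane_tree \<Rightarrow> nat \<Rightarrow> nat option" where
  "down_link T w = low w (T w)"

lemma down_link_eq: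
  assumes "T \<in> increasing_ordered_trees n"
  shows "down_link T w = (if T w = [] then None else Some (Min (set (T w))))"
  unfolding down_link_def using child_bounds[OF assms] by (intro low_all) auto

text \<open>
  The smallest child stands for all children, so being a violator depends on the two links only.
\<close>

lemma Klazar_violator_iff_links:
  assumes T: "T \<in> increasing_ordered_trees n"
  shows "Klazar_violator T w \<longleftrightarrow>
    (\<exists>a. left_link T w = Some a \<and> (\<forall>d. down_link T w = Some d \<longrightarrow> a < d))"
  unfolding Klazar_violator_def descent_terminator_def associate_def big_cohort_def
    left_link_def down_link_eq[OF T] low_def Let_def
  by auto

lemma nodes_eq_links:
  assumes T: "T \<in> increasing_ordered_trees n"
  shows "nodes T = {w\<in>{0<..n}. down_link T w \<noteq> None}"
  unfolding nodes_def has_parent_iff[OF T] down_link_eq[OF T] by auto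

lemma down_link_inj:
  assumes T: "T \<in> increasing_ordered_trees n" "down_link T u = Some v" "down_link T w = Some v"
  shows "u = w"
  using parent_unique[OF T(1)] T(2,3)[unfolded down_link_def, THEN low_SomeD(2)] by blast

section \<open>Links determine the tree\<close>

text \<open>
  The part of the sibling list that corresponds to the binary subtree with root \<open>w\<close>: the maximal
  segment around \<open>w\<close> whose other entries exceed \<open>w\<close>.
\<close>

definition run :: "nat plane_tree \<Rightarrow> nat \<Rightarrow> nat list" where
  "run T w = rev (takeWhile (\<lambda>x. w < x) (rev (cohort T w))) @ w # takeWhile (\<lambda>x. w < x) (later_siblings T w)"

lemma run_eq_segment:
  assumes T: "T \<in> increasing_ordered_trees n" and q: "T q = X @ S @ Y"
    and S: "S \<noteq> []" "a = Min (set S)" and X: "X = [] \<or> last X < a" and Y: "Y = [] \<or> hd Y < a"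
  shows "run T a = S"
proof -
  have "a \<in> set S" using S by simp
  then obtain P Q where PQ: "S = P @ a # Q" by (meson split_list)
  have "distinct S" using distinct_children[OF T, of q] q by simp
  then have "a \<notin> set P" "a \<notin> set Q" using PQ by auto
  moreover have "a \<le> x" if "x \<in> set P \<union> set Q" for x
    unfolding S(2) by (rule Min_le) (use that PQ in auto)
  ultimately have gt: "\<forall>x\<in>set P. a < x" "\<forall>x\<in>set Q. a < x"
    by (metis UnCI le_neq_implies_less)+
  have "cohort T a = X @ P" "later_siblings T a = Q @ Y"
    using siblings_split[OF T, of q "X @ P" a "Q @ Y"] q PQ by auto
  moreover have "takeWhile (\<lambda>x. a < x) (rev X) = []"
    using X by (cases X rule: rev_cases) auto
  moreover have "takeWhile (\<lambda>x. a < x) Y = []" using Y by (cases Y) auto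
  ultimately show ?thesis using gt PQ by (simp add: run_def takeWhile_append)
qed

lemma takeWhile_split:
  obtains zs where "xs = takeWhile P xs @ zs" "zs = [] \<or> \<not> P (hd zs)"
  using that[of "dropWhile P xs"] hd_dropWhile[of P xs] by auto

text \<open>
  The run to the left of \<open>w\<close> is bounded by \<open>w\<close> on one side and by an entry below \<open>w\<close> or the end of the
  list on the other. Both bounds are below its minimum \<open>a\<close>, so it is exactly the run of \<open>a\<close>; likewise
  on the right.
\<close>

lemma run_links:
  assumes T: "T \<in> increasing_ordered_trees n"
  shows "run T w = (case left_link T w of None \<Rightarrow> [] | Some a \<Rightarrow> run T a)
                    @ w # (case right_link T w of None \<Rightarrow> [] | Some a \<Rightarrow> run T a)"
proof (cases "has_parent T w")
  case False
  then show ?thesis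
    by (simp add: run_def left_link_def right_link_def no_siblings low_def)
next
  case True
  then obtain q P Q where q: "T q = P @ w # Q"
    unfolding has_parent_def by (meson split_list)
  have sib: "cohort T w = P" "later_siblings T w = Q" using siblings_split[OF T q] .
  have "distinct (T q)" by (rule distinct_children[OF T])
  then have w: "w \<notin> set P" "w \<notin> set Q" using q by auto
  let ?Z = "takeWhile (\<lambda>x. w < x) (rev P)"
  obtain zs where zs: "rev P = ?Z @ zs" "zs = [] \<or> \<not> w < hd zs" by (rule takeWhile_split)
  have P: "P = rev zs @ rev ?Z" using zs(1) by (metis rev_append rev_rev_ident)
  let ?Y = "takeWhile (\<lambda>x. w < x) Q"
  obtain ys where ys: "Q = ?Y @ ys" "ys = [] \<or> \<not> w < hd ys" by (rule takeWhile_split)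
  have l: "rev ?Z = (case left_link T w of None \<Rightarrow> [] | Some a \<Rightarrow> run T a)"
  proof (cases "left_link T w")
    case None
    then show ?thesis by (auto simp: left_link_def low_def sib Let_def split: if_splits)
  next
    case (Some a)
    then have a: "rev ?Z \<noteq> []" "a = Min (set (rev ?Z))"
      by (auto simp: left_link_def low_def sib Let_def split: if_splits)
    have "w < a" using Some low_SomeD(1) unfolding left_link_def by blast
    have "T q = rev zs @ rev ?Z @ w # Q" using q P by simp
    moreover have "rev zs = [] \<or> last (rev zs) < a"
      using zs(2) \<open>w < a\<close> by (auto simp: last_rev)
    ultimately have "run T a = rev ?Z"
      using a by (intro run_eq_segment[OF T, of q "rev zs" _ "w # Q"]) (use \<open>w < a\<close> in auto)
    then show ?thesis using Some by simp
  qed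
  have r: "?Y = (case right_link T w of None \<Rightarrow> [] | Some a \<Rightarrow> run T a)"
  proof (cases "right_link T w")
    case None
    then show ?thesis by (auto simp: right_link_def low_def sib Let_def split: if_splits)
  next
    case (Some a)
    then have a: "?Y \<noteq> []" "a = Min (set ?Y)"
      by (auto simp: right_link_def low_def sib Let_def split: if_splits)
    have "w < a" using Some low_SomeD(1) unfolding right_link_def by blast
    have "T q = (P @ [w]) @ ?Y @ ys" using q ys(1) by simp
    moreover have "ys = [] \<or> hd ys < a" using ys(2) \<open>w < a\<close> by auto
    ultimately have "run T a = ?Y"
      using a by (intro run_eq_segment[OF T, of q "P @ [w]" _ ys]) (use \<open>w < a\<close> in auto)
    then show ?thesis using Some by simp
  qed
  show ?thesis unfolding l[symmetric] r[symmetric] by (simp add: run_def sib)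
qed

lemma children_links:
  assumes T: "T \<in> increasing_ordered_trees n"
  shows "T w = (case down_link T w of None \<Rightarrow> [] | Some a \<Rightarrow> run T a)"
proof (cases "T w = []")
  case False
  then have "run T (Min (set (T w))) = T w" by (intro run_eq_segment[OF T, of w "[]" _ "[]"]) simp_all
  then show ?thesis unfolding down_link_eq[OF T] using False by simp
qed (simp add: down_link_eq[OF T])

lemma link_le:
  assumes T: "T \<in> increasing_ordered_trees n" and a: "left_link T w = Some a \<or> right_link T w = Some a"
  shows "w < a \<and> a \<le> n"
proof -
  have "has_parent T w"
    using a by (rule contrapos_pp) (simp add: left_link_def right_link_def no_siblings low_def)
  then obtain q P Q where q: "T q = P @ w # Q"
    unfolding has_parent_def by (meson split_list)
  have "w < a" "a \<in> set (T q)"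
    using a low_SomeD unfolding left_link_def right_link_def siblings_split[OF T q] q by fastforce+
  then show ?thesis using child_bounds(2)[OF T] by blast
qed

text \<open>
  Links lead to larger vertices, so \<open>run_links\<close> reconstructs all runs by downward induction on the
  vertex, and each list of children is the run of its minimum.
\<close>

lemma links_determine_tree:
  assumes T: "T \<in> increasing_ordered_trees n" and T': "T' \<in> increasing_ordered_trees n"
    and l: "\<And>w. left_link T w = left_link T' w" and r: "\<And>w. right_link T w = right_link T' w"
    and d: "\<And>w. down_link T w = down_link T' w"
  shows "T = T'"
proof
  have run: "run T w = run T' w" for w
  proof (induction "n - w" arbitrary: w rule: less_induct)
    case less
    have "run T a = run T' a" if "left_link T w = Some a \<or> right_link T w = Some a" for a
      using less[of a] link_le[OF T that] diff_less_mono2[of w a n] by auto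
    then show ?case
      unfolding run_links[OF T, of w] run_links[OF T', of w] l[symmetric] r[symmetric]
      by (auto split: option.splits)
  qed
  show "T w = T' w" for w
    unfolding children_links[OF T, of w] children_links[OF T', of w] d run ..
qed


section \<open>Processing a marked node\<close>

text \<open>
  Stated without reference to the order inside the lists, so that it serves for processing a node as
  well as for undoing such a step.
\<close>

lemma redistribute_children:
  assumes T: "T \<in> increasing_ordered_trees n" and "p \<noteq> u"
    and dist: "distinct (xs @ ys)" and set_eq: "set xs \<union> set ys = set (T p) \<union> set (T u)"
    and gt: "\<forall>x\<in>set xs. p < x" "\<forall>y\<in>set ys. u < y"
  shows "T(p := xs, u := ys) \<in> increasing_ordered_trees n" (is "?T' \<in> _")
  unfolding increasing_ordered_trees_iff
proof (intro conjI allI ballI)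
  fix v
  show "distinct (?T' v)" using dist distinct_children[OF T, of v] by simp
  have "set (T p) \<union> set (T u) \<subseteq> {..n}" using child_bounds(2)[OF T] by auto
  then have "set xs \<union> set ys \<subseteq> {..n}" using set_eq by simp
  then have "set xs \<subseteq> {p<..n}" "set ys \<subseteq> {u<..n}" using gt by auto
  moreover have "set (T v) \<subseteq> {v<..n}" using T unfolding increasing_ordered_trees_iff by blast
  ultimately show "set (?T' v) \<subseteq> {v<..n}" by simp
next
  fix w assume "w \<in> {0<..n}"
  then obtain q where q: "w \<in> set (T q)" and q': "\<And>x. w \<in> set (T x) \<Longrightarrow> x = q"
    using T unfolding increasing_ordered_trees_iff by blast
  have "w \<in> set (?T' x) \<longleftrightarrow> x = (if w \<in> set xs then p else if w \<in> set ys then u else q)" for x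
  proof (cases "w \<in> set xs \<union> set ys")
    case True
    then have "q = p \<or> q = u" using set_eq q' by blast
    then show ?thesis using True dist \<open>p \<noteq> u\<close> by (auto dest: q')
  next
    case False
    then have "q \<noteq> p" "q \<noteq> u" using set_eq q by auto
    then show ?thesis using False q by (auto dest: q')
  qed
  then show "\<exists>!x. w \<in> set (?T' x)" by auto
qed

text \<open>
  One step \<open>T \<mapsto> T'\<close>, with the two affected lists cut into the pieces that the step moves. The
  conditions on \<open>L\<close> and \<open>B\<close> say that \<open>B\<close> is the big cohort of \<open>u\<close> and that \<open>u\<close> is not a violator
  in \<open>T\<close>: \<open>B\<close> is empty or its minimum exceeds the smallest child \<open>v\<close>.
\<close>

locale transfer =
  fixes n u p v :: nat and L B R C D :: "nat list" and T T' :: "nat plane_tree"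
  assumes tree: "T \<in> increasing_ordered_trees n"
    and parent_list: "T p = L @ B @ u # R"
    and child_list: "T u = C @ v # D"
    and last_less: "L = [] \<or> last L < u"
    and B_gt: "\<forall>x\<in>set B. v < x"
    and v_min: "\<forall>x\<in>set C \<union> set D. v < x"
    and result: "T' = T(p := L @ C @ v # B @ u # R, u := D)"
begin

lemma less: "p < u" "u < v"
  using child_bounds(1)[OF tree, of u p] child_bounds(1)[OF tree, of v u] parent_list child_list
  by auto

lemma greater: "\<forall>x\<in>set B. u < x" "\<forall>x\<in>set C. u < x" "\<forall>x\<in>set D. u < x"
  using B_gt v_min less(2) by (meson UnI1 UnI2 less_trans)+

lemma Min_children: "Min (set (T u)) = v"
  unfolding child_list using v_min by (intro Min_eqI) (auto intro: less_imp_le)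

lemma result_tree: "T' \<in> increasing_ordered_trees n"
  unfolding result
proof (rule redistribute_children[OF tree])
  have "x \<notin> set (T u)" if "x \<in> set (T p)" for x
    using parent_unique[OF tree that, of u] less(1) by auto
  then have "distinct (T p @ T u)" using distinct_children[OF tree] by auto
  then show "distinct ((L @ C @ v # B @ u # R) @ D)" unfolding parent_list child_list by auto
  show "\<forall>y\<in>set D. u < y" by (rule greater(3))
  have "\<forall>x\<in>set (T p). p < x" using child_bounds(1)[OF tree] by blast
  then show "\<forall>x\<in>set (L @ C @ v # B @ u # R). p < x"
    unfolding parent_list using less greater(2) by fastforce
qed (use less parent_list child_list in auto)

lemma result_lists: "T' p = L @ C @ v # B @ u # R" "T' u = D" "q \<noteq> p \<Longrightarrow> q \<noteq> u \<Longrightarrow> T' q = T q"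
  unfolding result using less by auto

lemma process_eq: "process u T = T'"
proof -
  have "takeWhile (\<lambda>x. u < x) (rev B) = rev B"
    using greater(1) by (simp add: takeWhile_eq_all_conv)
  moreover have "takeWhile (\<lambda>x. u < x) (rev L) = []"
    using last_less by (auto simp: takeWhile_eq_Nil_iff hd_rev)
  moreover have co: "cohort T u = L @ B"
    using siblings_split(1)[OF tree, of p "L @ B" u R] parent_list by simp
  ultimately have "big_cohort T u = B"
    using greater(1) by (simp add: big_cohort_def takeWhile_append)
  moreover note Min_children
  moreover have "cohort T v = C" by (rule siblings_split(1)[OF tree child_list])
  moreover have "parent T u = p" by (rule parent_eq[OF tree]) (simp add: parent_list)
  ultimately show ?thesis
    unfolding process_def result Let_def co by (simp add: parent_list child_list)
qed

lemma down_link_T: "down_link T u = Some v"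
  unfolding down_link_eq[OF tree] Min_children by (simp add: child_list)

lemma down_link_T': "down_link T' w = (if w = u then right_link T v else down_link T w)"
proof -
  have "right_link T v = low v D"
    unfolding right_link_def siblings_split(2)[OF tree child_list] ..
  also have "\<dots> = down_link T' u"
    unfolding down_link_def result_lists using v_min greater(3) low_all[of D v] low_all[of D u] by simp
  moreover have "down_link T' p = down_link T p"
    using low_remove(1)[of p u "C @ [v]" B L R] less greater
    unfolding down_link_def result_lists parent_list by auto
  ultimately show ?thesis
    by (cases "w = p") (auto simp: result_lists(3) down_link_def)
qed

lemma last_less': "u \<le> w \<Longrightarrow> rev L = [] \<or> hd (rev L) < w"
  using last_less by (auto simp: hd_rev)

lemma links_own:
  shows "left_link T' u = Some v" "right_link T' u = right_link T u"
    "left_link T' v = left_link T v" "right_link T' v = left_link T u"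
proof -
  note s = siblings_split[OF tree, of p "L @ B" u R, unfolded parent_list append_assoc, OF refl]
    siblings_split[OF result_tree, of p "L @ C @ v # B" u R, unfolded result_lists, simplified]
    siblings_split[OF tree child_list]
    siblings_split[OF result_tree, of p "L @ C" v "B @ u # R", unfolded result_lists, simplified]
  note B = greater(1)
  have "low u ((rev B @ v # rev C) @ rev L) = low u (rev B @ v # rev C)"
    by (rule low_stop) (rule last_less'[OF order_refl])
  also have "\<dots> = Some (Min (set (rev B @ v # rev C)))"
    using greater less by (subst low_all) auto
  also have "Min (set (rev B @ v # rev C)) = v" using B_gt v_min by (intro Min_eqI) (auto intro: less_imp_le)
  finally show "left_link T' u = Some v" by (simp add: left_link_def s)
  show "right_link T' u = right_link T u" by (simp add: right_link_def s)
  show "left_link T' v = left_link T v"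
    using low_stop[OF last_less'[of v], of "rev C"] less by (simp add: left_link_def s)
  have "low v (B @ u # R) = low v B" using less by (intro low_stop) simp
  also have "\<dots> = low u (rev B)" using B B_gt low_all[of B v] low_all[of "rev B" u] by simp
  also have "\<dots> = low u (rev B @ rev L)" by (rule low_stop[symmetric]) (rule last_less'[OF order_refl])
  finally show "right_link T' v = left_link T u" by (simp add: left_link_def right_link_def s)
qed

text \<open>
  The moved block \<open>C @ [v]\<close> is invisible to every other vertex. A vertex below \<open>u\<close> that looks across
  the block also sees the smaller entry \<open>u\<close>. A vertex above \<open>u\<close> meets \<open>u\<close>, \<open>v\<close> or the last entry
  of \<open>L\<close>, all smaller than itself, before its view of the list could change; for \<open>w\<close> in \<open>B\<close> this
  needs \<open>v < w\<close>, that is, that \<open>u\<close> was not a violator.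
\<close>

lemma links_other:
  assumes "w \<noteq> u" "w \<noteq> v"
  shows "left_link T' w = left_link T w \<and> right_link T' w = right_link T w"
proof (cases "has_parent T w")
  case False
  then have "\<not> has_parent T' w" unfolding has_parent_iff[OF tree] has_parent_iff[OF result_tree] .
  then show ?thesis using False by (simp add: left_link_def right_link_def no_siblings)
next
  case True
  then obtain q where q: "w \<in> set (T q)" unfolding has_parent_def by blast
  have M: "\<forall>x\<in>set (C @ [v]). u < x" "\<forall>x\<in>set (v # rev C). u < x" and B: "\<forall>x\<in>set B. u < x"
    "\<forall>x\<in>set (rev B). u < x"
    using greater less by auto
  have pq: "q = p \<Longrightarrow> w \<in> set L \<union> set B \<union> set R" "q = u \<Longrightarrow> w \<in> set C \<union> set D"
    using q assms by (auto simp: parent_list child_list)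
  consider (other) "q \<noteq> p" "q \<noteq> u" | (L) "q = p" "w \<in> set L" | (B) "q = p" "w \<in> set B"
    | (R) "q = p" "w \<in> set R" | (C) "q = u" "w \<in> set C" | (D) "q = u" "w \<in> set D"
    using pq by blast
  then show ?thesis
  proof cases
    case other
    obtain P Q where PQ: "T q = P @ w # Q" using q by (meson split_list)
    show ?thesis
      using siblings_split[OF tree PQ] siblings_split[OF result_tree, of q P w Q] PQ
      by (simp add: left_link_def right_link_def result_lists other)
  next
    case L
    obtain L1 L2 where L12: "L = L1 @ w # L2" using L by (meson split_list)
    note s = siblings_split[OF tree, of p L1 w "L2 @ B @ u # R"]
      siblings_split[OF result_tree, of p L1 w "L2 @ C @ v # B @ u # R"]
    \<comment> \<open>If \<open>w > u\<close>, the last entry of \<open>L\<close> is not \<open>w\<close>, so it lies in \<open>L2\<close> and stops the scan.\<close>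
    have "low w (L2 @ (C @ [v]) @ B @ u # R) = low w (L2 @ B @ u # R)"
    proof (cases "w < u")
      case True
      show ?thesis by (rule low_remove(1)[OF True M(1) B(1)])
    next
      case False
      have "L2 \<noteq> [] \<and> last L2 < w" using False last_less L12 \<open>w \<noteq> u\<close> by (cases L2) auto
      then have "\<exists>x\<in>set L2. x < w" by force
      then show ?thesis by (simp only: low_cut)
    qed
    then show ?thesis
      using s L12 by (simp add: left_link_def right_link_def parent_list result_lists)
  next
    case B
    obtain B1 B2 where B12: "B = B1 @ w # B2" using B by (meson split_list)
    have "v < w" using B_gt B by auto
    note s = siblings_split[OF tree, of p "L @ B1" w "B2 @ u # R"]
      siblings_split[OF result_tree, of p "L @ C @ v # B1" w "B2 @ u # R"]
    have "low w (rev B1 @ v # rev C @ rev L) = low w (rev B1)"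
      using \<open>v < w\<close> by (intro low_stop) simp
    moreover have "low w (rev B1 @ rev L) = low w (rev B1)"
      using \<open>v < w\<close> less by (intro low_stop last_less') simp
    ultimately show ?thesis
      using s B12 by (simp add: left_link_def right_link_def parent_list result_lists)
  next
    case R
    obtain R1 R2 where R12: "R = R1 @ w # R2" using R by (meson split_list)
    note s = siblings_split[OF tree, of p "L @ B @ u # R1" w R2]
      siblings_split[OF result_tree, of p "L @ C @ v # B @ u # R1" w R2]
    have "low w (rev R1 @ u # rev B @ (v # rev C) @ rev L) = low w (rev R1 @ u # rev B @ rev L)"
    proof (cases "w < u")
      case True
      show ?thesis by (rule low_remove(2)[OF True M(2) B(2)])
    next
      case False
      then have "\<exists>x\<in>set (rev R1 @ [u]). x < w" using \<open>w \<noteq> u\<close> by auto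
      then have *: "low w ((rev R1 @ [u]) @ Q) = low w (rev R1 @ [u])" for Q by (rule low_cut)
      show ?thesis using *[of "rev B @ (v # rev C) @ rev L"] *[of "rev B @ rev L"] by simp
    qed
    then show ?thesis
      using s R12 by (simp add: left_link_def right_link_def parent_list result_lists)
  next
    case C
    obtain C1 C2 where C12: "C = C1 @ w # C2" using C by (meson split_list)
    have "v < w" using v_min C by auto
    note s = siblings_split[OF tree, of u C1 w "C2 @ v # D"]
      siblings_split[OF result_tree, of p "L @ C1" w "C2 @ v # B @ u # R"]
    have "low w (rev C1 @ rev L) = low w (rev C1)"
      using \<open>v < w\<close> less by (intro low_stop last_less') simp
    moreover have "low w (C2 @ v # Y) = low w C2" for Y
      using \<open>v < w\<close> by (intro low_stop) simp
    ultimately show ?thesis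
      using s C12 by (simp add: left_link_def right_link_def child_list result_lists)
  next
    case D
    obtain D1 D2 where D12: "D = D1 @ w # D2" using D by (meson split_list)
    have "v < w" using v_min D by auto
    note s = siblings_split[OF tree, of u "C @ v # D1" w D2]
      siblings_split[OF result_tree, of u D1 w D2]
    have "low w (rev D1 @ v # rev C) = low w (rev D1)"
      using \<open>v < w\<close> by (intro low_stop) simp
    then show ?thesis
      using s D12 by (simp add: left_link_def right_link_def child_list result_lists)
  qed
qed

lemma left_link_T': "left_link T' w = (if w = u then Some v else left_link T w)"
  and right_link_T': "right_link T' w = (if w = v then left_link T u else right_link T w)"
  using links_own links_other[of w] less by auto


text \<open>
  Before the step an associate of \<open>u\<close> would lie in \<open>B\<close> and exceed \<open>v\<close>; afterwards \<open>v\<close> itself is the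
  associate and all remaining children of \<open>u\<close> exceed it. Other vertices keep their left and down links.
\<close>

lemma violators: "{w. Klazar_violator T' w} = insert u {w. Klazar_violator T w}"
  and not_violator: "\<not> Klazar_violator T u"
proof -
  have T: "v < a" if "left_link T u = Some a" for a
    using that low_SomeD(1)[of v _ a] by (simp flip: links_own(4) add: right_link_def)
  then show "\<not> Klazar_violator T u"
    unfolding Klazar_violator_iff_links[OF tree] down_link_T by fastforce
  have "v < d" if "down_link T' u = Some d" for d
    using that low_SomeD(1)[of v _ d] by (simp add: down_link_T' right_link_def)
  then have "Klazar_violator T' w \<longleftrightarrow> w = u \<or> Klazar_violator T w" for w
    unfolding Klazar_violator_iff_links[OF tree] Klazar_violator_iff_links[OF result_tree]
      left_link_T' down_link_T' by auto
  then show "{w. Klazar_violator T' w} = insert u {w. Klazar_violator T w}" by auto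
qed

lemma nodes_T: "u \<in> nodes T" "nodes T' \<subseteq> nodes T" "nodes T - {u} \<subseteq> nodes T'"
proof -
  have "u \<le> n" using child_bounds(2)[OF tree, of u p] by (simp add: parent_list)
  then show "u \<in> nodes T" "nodes T' \<subseteq> nodes T" "nodes T - {u} \<subseteq> nodes T'"
    unfolding nodes_eq_links[OF tree] nodes_eq_links[OF result_tree]
    using less by (auto simp: down_link_T down_link_T' split: if_splits)
qed

end

lemma big_cohort_split:
  assumes T: "T \<in> increasing_ordered_trees n" and p: "T p = P @ u # R"
  obtains L where "P = L @ big_cohort T u" "L = [] \<or> last L < u" "\<forall>x\<in>set (big_cohort T u). u < x"
proof -
  let ?Z = "takeWhile (\<lambda>x. u < x) (rev P)"
  obtain zs where zs: "rev P = ?Z @ zs" "zs = [] \<or> \<not> u < hd zs" by (rule takeWhile_split)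
  have Z: "big_cohort T u = rev ?Z" unfolding big_cohort_def siblings_split(1)[OF T p] ..
  have P: "P = rev zs @ rev ?Z" using zs(1) by (metis rev_append rev_rev_ident)
  have "u \<notin> set P" using distinct_children[OF T, of p] p by simp
  then have "u \<notin> set zs" using P by (metis Un_iff set_append set_rev)
  then have "zs \<noteq> [] \<Longrightarrow> hd zs \<noteq> u" by (metis hd_in_set)
  then have "rev zs = [] \<or> last (rev zs) < u"
    using zs(2) by (metis last_rev linorder_neqE_nat rev_is_Nil_conv)
  moreover have "\<forall>x\<in>set (rev ?Z). u < x" by (auto dest: set_takeWhileD)
  ultimately show ?thesis using that[of "rev zs"] P unfolding Z by blast
qed

lemma split_list_Min:
  fixes xs :: "nat list"
  assumes "xs \<noteq> []" "distinct xs"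
  obtains C D where "xs = C @ Min (set xs) # D" "\<forall>x\<in>set C \<union> set D. Min (set xs) < x"
proof -
  have "Min (set xs) \<in> set xs" using assms(1) by simp
  then obtain C D where CD: "xs = C @ Min (set xs) # D" by (meson split_list)
  have "Min (set xs) < x" if "x \<in> set C \<union> set D" for x
  proof -
    have "x \<in> set xs" using CD that by (metis UnCI UnE list.set_intros(2) set_append)
    then have "Min (set xs) \<le> x" by simp
    moreover have "distinct (C @ Min (set xs) # D)" using assms(2) CD by simp
    then have "x \<noteq> Min (set xs)" using that by auto
    ultimately show ?thesis by simp
  qed
  then show ?thesis using that CD by blast
qed

text \<open>
  Some child of \<open>u\<close> is at most the associate of \<open>u\<close>, hence so is the smallest child \<open>v\<close>, and
  they differ because they have different parents. This gives \<open>v < b\<close> for all \<open>b\<close> in the big cohort.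
\<close>

lemma process_transfer:
  assumes T: "T \<in> increasing_ordered_trees n" and u: "u \<in> nodes T" "\<not> Klazar_violator T u"
  obtains p v L B R C D where "transfer n u p v L B R C D T (process u T)"
proof -
  obtain p P R where p: "T p = P @ u # R"
    using u(1) unfolding nodes_def has_parent_def by (auto dest: split_list)
  let ?B = "big_cohort T u"
  obtain L where L: "P = L @ ?B" "L = [] \<or> last L < u"
    using big_cohort_split[OF T p] by metis
  let ?v = "Min (set (T u))"
  have ne: "T u \<noteq> []" using u(1) by (simp add: nodes_def)
  then obtain C D where CD: "T u = C @ ?v # D" "\<forall>x\<in>set C \<union> set D. ?v < x"
    using split_list_Min[OF _ distinct_children[OF T]] by metis
  have "?v < b" if b: "b \<in> set ?B" for b
  proof -
    obtain c where c: "c \<in> set (T u)" "\<not> associate T u < c"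
      using u(2) b unfolding Klazar_violator_def descent_terminator_def by force
    have "?v \<le> c" using c(1) by simp
    also have "c \<le> associate T u" using c(2) by simp
    also have "\<dots> \<le> b" unfolding associate_def using b by simp
    finally have "?v \<le> b" .
    moreover have "b \<in> set (T p)" using b L(1) p by simp
    then have "b \<notin> set (T u)"
      using parent_unique[OF T, of b p u] child_bounds(1)[OF T, of u p] p by auto
    then have "b \<noteq> ?v" using ne by (metis List.finite_set Min_in set_empty)
    ultimately show ?thesis by simp
  qed
  then have tr: "transfer n u p ?v L ?B R C D T (T(p := L @ C @ ?v # ?B @ u # R, u := D))"
    using T p L CD by unfold_locales auto
  then show ?thesis using that transfer.process_eq[OF tr] by simp
qed

text \<open>
  To undo a step, cut the big cohort of \<open>u\<close> just after its minimum, the associate, and give the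
  left part back to \<open>u\<close> as its first children. The remaining children exceed the associate because
  \<open>u\<close> is a violator, so the associate becomes the smallest child.
\<close>

lemma violator_transfer:
  assumes T': "T' \<in> increasing_ordered_trees n" and u: "Klazar_violator T' u"
  obtains T p v L B R C D where "transfer n u p v L B R C D T T'"
proof -
  let ?X = "big_cohort T' u"
  have ne: "?X \<noteq> []" using u unfolding Klazar_violator_def descent_terminator_def by blast
  then have "has_parent T' u" by (auto simp: big_cohort_def cohort_def split: if_splits)
  then obtain p P R where p: "T' p = P @ u # R"
    unfolding has_parent_def by (auto dest: split_list)
  obtain L where L: "P = L @ ?X" "L = [] \<or> last L < u" "\<forall>x\<in>set ?X. u < x"
    using big_cohort_split[OF T' p] by metis
  have dist: "distinct (T' p)" by (rule distinct_children[OF T'])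
  then have "distinct ?X" using p L(1) by auto
  let ?v = "Min (set ?X)"
  obtain C B where CB: "?X = C @ ?v # B" "\<forall>x\<in>set C \<union> set B. ?v < x"
    using split_list_Min[OF ne \<open>distinct ?X\<close>] by metis
  have D: "\<forall>d\<in>set (T' u). ?v < d" using u unfolding Klazar_violator_def associate_def by blast
  have p': "T' p = L @ C @ ?v # B @ u # R"
    using p L(1) CB(1) by (metis append.assoc append_Cons)
  have "p < u" using child_bounds(1)[OF T', of u p] p by simp
  define T where "T = T'(p := L @ B @ u # R, u := C @ ?v # T' u)"
  have "T \<in> increasing_ordered_trees n"
    unfolding T_def
  proof (rule redistribute_children[OF T'])
    show "p \<noteq> u" using \<open>p < u\<close> by simp
    have "x \<notin> set (T' u)" if "x \<in> set (T' p)" for x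
      using parent_unique[OF T' that, of u] \<open>p < u\<close> by auto
    then have "distinct (T' p @ T' u)" using distinct_children[OF T'] by auto
    then show "distinct ((L @ B @ u # R) @ C @ ?v # T' u)" unfolding p' by auto
    show "set (L @ B @ u # R) \<union> set (C @ ?v # T' u) = set (T' p) \<union> set (T' u)"
      unfolding p' by auto
    have "\<forall>x\<in>set (T' p). p < x" using child_bounds(1)[OF T'] by blast
    then show "\<forall>x\<in>set (L @ B @ u # R). p < x" unfolding p' by auto
    have "u < x" if "x \<in> set C \<or> x = ?v" for x
    proof -
      have "x \<in> set ?X" by (subst CB(1)) (use that in auto)
      then show ?thesis using L(3) by blast
    qed
    then show "\<forall>y\<in>set (C @ ?v # T' u). u < y"
      using child_bounds(1)[OF T'] by auto
  qed
  moreover have "T' = T(p := L @ C @ ?v # B @ u # R, u := T' u)"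
    unfolding T_def using p' by (simp add: fun_eq_iff)
  moreover have "T p = L @ B @ u # R" "T u = C @ ?v # T' u"
    unfolding T_def using \<open>p < u\<close> by auto
  ultimately have "transfer n u p ?v L B R C (T' u) T T'"
    using L(2) CB(2) D by (intro transfer.intro) auto
  then show ?thesis by (rule that)
qed

section \<open>Processing several marked nodes\<close>

lemma down_link_node:
  assumes "T \<in> increasing_ordered_trees n" "u \<in> nodes T"
  obtains v where "down_link T u = Some v"
  using assms by (auto simp: nodes_eq_links)

text \<open>
  All links are expressed by links of the original tree. For the right links, the vertices that
  change are the smallest children of the processed vertices; these are distinct, so a step
  does not disturb the three links that any other step uses.
\<close>

lemma fold_process:
  assumes T: "T \<in> increasing_ordered_trees n"
    and us: "distinct us" "set us \<subseteq> nodes T" "\<forall>u\<in>set us. \<not> Klazar_violator T u"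
  defines "T' \<equiv> fold process us T"
  shows fold_process_tree: "T' \<in> increasing_ordered_trees n"
    and fold_process_violators: "{w. Klazar_violator T' w} = {w. Klazar_violator T w} \<union> set us"
    and fold_process_nodes: "nodes T - set us \<subseteq> nodes T'" "nodes T' \<subseteq> nodes T"
    and fold_process_left: "left_link T' w = (if w \<in> set us then down_link T w else left_link T w)"
    and fold_process_down:
      "down_link T' w = (if w \<in> set us then right_link T (the (down_link T w)) else down_link T w)"
    and fold_process_right:
      "u \<in> set us \<Longrightarrow> right_link T' (the (down_link T u)) = left_link T u"
      "\<forall>u\<in>set us. down_link T u \<noteq> Some x \<Longrightarrow> right_link T' x = right_link T x"
proof -
  have "T' \<in> increasing_ordered_trees n
    \<and> {w. Klazar_violator T' w} = {w. Klazar_violator T w} \<union> set us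
    \<and> nodes T - set us \<subseteq> nodes T' \<and> nodes T' \<subseteq> nodes T
    \<and> (\<forall>w. left_link T' w = (if w \<in> set us then down_link T w else left_link T w))
    \<and> (\<forall>w. down_link T' w =
          (if w \<in> set us then right_link T (the (down_link T w)) else down_link T w))
    \<and> (\<forall>u\<in>set us. right_link T' (the (down_link T u)) = left_link T u)
    \<and> (\<forall>x. (\<forall>u\<in>set us. down_link T u \<noteq> Some x) \<longrightarrow> right_link T' x = right_link T x)"
    unfolding T'_def using us
  proof (induction us rule: rev_induct)
    case Nil
    show ?case using T by simp
  next
    case (snoc u us)
    define S where "S = fold process us T"
    have u: "u \<notin> set us" "u \<in> nodes T" "\<not> Klazar_violator T u" "distinct us" "set us \<subseteq> nodes T"
      "\<forall>x\<in>set us. \<not> Klazar_violator T x"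
      using snoc.prems by auto
    note IH = snoc.IH[OF u(4-6), folded S_def]
    have S: "S \<in> increasing_ordered_trees n" using IH by blast
    have uS: "u \<in> nodes S" "\<not> Klazar_violator S u" using u(1-3) IH by blast+
    obtain p v L B R C D where "transfer n u p v L B R C D S (process u S)"
      by (rule process_transfer[OF S uS])
    then interpret transfer n u p v L B R C D S "process u S" .
    have f: "fold process (us @ [u]) T = process u S" by (simp add: S_def)
    \<comment> \<open>Processing the vertices of \<open>us\<close> has not touched the links that the step at \<open>u\<close> uses.\<close>
    have v: "down_link T u = Some v" using down_link_T IH u(1) by simp
    have ne: "down_link T x \<noteq> Some v" if "x \<in> set us" for x
      using down_link_inj[OF T v, of x] that u(1) by blast
    have ne': "the (down_link T x) \<noteq> v" if x: "x \<in> set us" for x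
    proof -
      obtain y where "down_link T x = Some y" using down_link_node[OF T] u(5) x by blast
      then show ?thesis using ne[OF x] by simp
    qed
    show ?case
      unfolding f
    proof (intro conjI allI ballI impI)
      show "process u S \<in> increasing_ordered_trees n" by (rule result_tree)
      show "{w. Klazar_violator (process u S) w} = {w. Klazar_violator T w} \<union> set (us @ [u])"
        unfolding violators using IH by auto
      show "nodes T - set (us @ [u]) \<subseteq> nodes (process u S)" using nodes_T(3) IH by auto
      show "nodes (process u S) \<subseteq> nodes T" using nodes_T(2) IH by blast
      fix w
      show "left_link (process u S) w
          = (if w \<in> set (us @ [u]) then down_link T w else left_link T w)"
        unfolding left_link_T' using IH v by simp
      have "right_link S v = right_link T v" using IH ne by blast
      then show "down_link (process u S) w
          = (if w \<in> set (us @ [u]) then right_link T (the (down_link T w)) else down_link T w)"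
        unfolding down_link_T' using IH v by simp
    next
      fix x assume x: "x \<in> set (us @ [u])"
      show "right_link (process u S) (the (down_link T x)) = left_link T x"
      proof (cases "x = u")
        case True
        have "left_link S u = left_link T u" using IH u(1) by simp
        then show ?thesis unfolding right_link_T' using True v by simp
      next
        case False
        then have "x \<in> set us" using x by simp
        then show ?thesis unfolding right_link_T' using ne' IH by simp
      qed
    next
      fix x assume "\<forall>y\<in>set (us @ [u]). down_link T y \<noteq> Some x"
      then have "x \<noteq> v" "\<forall>y\<in>set us. down_link T y \<noteq> Some x" using v by auto
      then show "right_link (process u S) x = right_link T x"
        unfolding right_link_T' using IH by simp
    qed
  qed
  then show "T' \<in> increasing_ordered_trees n"
    "{w. Klazar_violator T' w} = {w. Klazar_violator T w} \<union> set us"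
    "nodes T - set us \<subseteq> nodes T'" "nodes T' \<subseteq> nodes T"
    "left_link T' w = (if w \<in> set us then down_link T w else left_link T w)"
    "down_link T' w = (if w \<in> set us then right_link T (the (down_link T w)) else down_link T w)"
    "u \<in> set us \<Longrightarrow> right_link T' (the (down_link T u)) = left_link T u"
    "\<forall>u\<in>set us. down_link T u \<noteq> Some x \<Longrightarrow> right_link T' x = right_link T x"
    by blast+
qed

lemma fold_process_order:
  assumes T: "T \<in> increasing_ordered_trees n"
    and M: "M \<subseteq> nodes T" "\<forall>u\<in>M. \<not> Klazar_violator T u"
    and us: "distinct us" "set us = M" and ws: "distinct ws" "set ws = M"
  shows "fold process us T = fold process ws T"
proof (rule links_determine_tree)
  note f = T us(1) M[folded us(2)] and g = T ws(1) M[folded ws(2)]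
  show "fold process us T \<in> increasing_ordered_trees n" by (rule fold_process_tree[OF f])
  show "fold process ws T \<in> increasing_ordered_trees n" by (rule fold_process_tree[OF g])
  fix w
  show "left_link (fold process us T) w = left_link (fold process ws T) w"
    unfolding fold_process_left[OF f] fold_process_left[OF g] us ws ..
  show "down_link (fold process us T) w = down_link (fold process ws T) w"
    unfolding fold_process_down[OF f] fold_process_down[OF g] us ws ..
  show "right_link (fold process us T) w = right_link (fold process ws T) w"
  proof (cases "\<exists>u\<in>M. down_link T u = Some w")
    case True
    then obtain u where "u \<in> M" "w = the (down_link T u)" by force
    then show ?thesis
      using fold_process_right(1)[OF f, of u] fold_process_right(1)[OF g, of u] us ws by simp
  next
    case False
    then show ?thesis
      using fold_process_right(2)[OF f, of w] fold_process_right(2)[OF g, of w] us ws by simp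
  qed
qed

text \<open>
  The closed form can be inverted: for a processed \<open>u\<close>, the old down link is the new left link, the
  old left link is the new right link of the old smallest child, and the old right link of that child is
  the new down link of \<open>u\<close>.
\<close>

lemma fold_process_inj:
  assumes S: "S \<in> increasing_ordered_trees n" and T: "T \<in> increasing_ordered_trees n"
    and us: "distinct us"
    and uS: "set us \<subseteq> nodes S" "\<forall>u\<in>set us. \<not> Klazar_violator S u"
    and uT: "set us \<subseteq> nodes T" "\<forall>u\<in>set us. \<not> Klazar_violator T u"
    and eq: "fold process us S = fold process us T"
  shows "S = T"
proof (rule links_determine_tree[OF S T])
  note f = S us uS and g = T us uT
  show d: "down_link S w = down_link T w" for w
    using fold_process_left[OF f, of w] fold_process_left[OF g, of w]
      fold_process_down[OF f, of w] fold_process_down[OF g, of w] eq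
    by (cases "w \<in> set us") auto
  show "left_link S w = left_link T w" for w
    using fold_process_left[OF f, of w] fold_process_left[OF g, of w]
      fold_process_right(1)[OF f, of w] fold_process_right(1)[OF g, of w] eq d[of w]
    by (cases "w \<in> set us") auto
  fix w
  show "right_link S w = right_link T w"
  proof (cases "\<exists>u\<in>set us. down_link T u = Some w")
    case True
    then obtain u where "u \<in> set us" "w = the (down_link T u)" by force
    then show ?thesis
      using fold_process_down[OF f, of u] fold_process_down[OF g, of u] d[of u] eq by simp
  next
    case False
    then show ?thesis
      using fold_process_right(2)[OF f, of w] fold_process_right(2)[OF g, of w] eq d by simp
  qed
qed

lemma finite_nodes: "T \<in> increasing_ordered_trees n \<Longrightarrow> finite (nodes T)"
  by (rule finite_subset[of _ "{0<..n}"]) (auto simp: nodes_eq_links)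

lemma finite_violators:
  assumes T: "T \<in> increasing_ordered_trees n"
  shows "finite {w. Klazar_violator T w}"
proof (rule finite_subset)
  show "{w. Klazar_violator T w} \<subseteq> {0<..n}"
    using has_parent_iff[OF T] no_siblings(1)
    by (fastforce simp: Klazar_violator_def descent_terminator_def big_cohort_def)
qed simp

text \<open>
  Undoing one violator leaves the other violators as they are, so the induction is on their number.
  The step just undone is the last one to be performed.
\<close>

lemma fold_process_surj:
  assumes "T' \<in> increasing_ordered_trees n"
  shows "\<exists>T us. T \<in> Klazar_trees n \<and> distinct us \<and> set us \<subseteq> nodes T \<and> fold process us T = T'"
  using assms
proof (induction "card {w. Klazar_violator T' w}" arbitrary: T')
  case 0
  then have "{w. Klazar_violator T' w} = {}" using finite_violators by simp
  then have "T' \<in> Klazar_trees n" using 0 by (auto simp: Klazar_trees_def)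
  then show ?case by (intro exI[of _ T'] exI[of _ "[]"]) simp
next
  case (Suc k)
  then have "{w. Klazar_violator T' w} \<noteq> {}" by (metis card.empty nat.distinct(1))
  then obtain u where "Klazar_violator T' u" by blast
  then obtain S p v L B R C D where "transfer n u p v L B R C D S T'"
    using violator_transfer[OF Suc.prems] by metis
  then interpret transfer n u p v L B R C D S T' .
  have "k = card {w. Klazar_violator S w}"
    using Suc.hyps(2) not_violator finite_violators[OF tree] unfolding violators by simp
  from Suc.hyps(1)[OF this tree] obtain T us where T: "T \<in> Klazar_trees n"
    and us: "distinct us" "set us \<subseteq> nodes T" and S: "fold process us T = S" by blast
  have T0: "T \<in> increasing_ordered_trees n" "\<forall>u\<in>set us. \<not> Klazar_violator T u"
    using T by (auto simp: Klazar_trees_def)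
  have "u \<in> nodes T" using fold_process_nodes(2)[OF T0(1) us T0(2)] nodes_T(1) S by blast
  moreover have "u \<notin> set us"
    using fold_process_violators[OF T0(1) us T0(2)] not_violator S by blast
  ultimately show ?case
    using T us S process_eq by (intro exI[of _ T] exI[of _ "us @ [u]"]) simp
qed

section \<open>Counting\<close>

lemma sum_length_children:
  assumes T: "T \<in> increasing_ordered_trees n"
  shows "(\<Sum>v\<le>n. length (T v)) = n"
proof -
  have "(\<Sum>v\<le>n. length (T v)) = (\<Sum>v\<le>n. card (set (T v)))"
    by (intro sum.cong refl) (simp add: distinct_card distinct_children[OF T])
  also have "\<dots> = card (\<Union>v\<le>n. set (T v))"
    by (rule card_UN_disjoint[symmetric]) (use parent_unique[OF T] in auto)
  also have "(\<Union>v\<le>n. set (T v)) = {0<..n}"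
  proof (intro equalityI subsetI)
    fix w assume "w \<in> {0<..n}"
    then obtain v where v: "w \<in> set (T v)"
      using has_parent_iff[OF T] unfolding has_parent_def by blast
    then have "v \<le> n" using child_bounds[OF T v] by simp
    then show "w \<in> (\<Union>v\<le>n. set (T v))" using v by blast
  qed (use child_bounds[OF T] in fastforce)
  finally show ?thesis by simp
qed

definition insert_leaf :: "nat \<Rightarrow> nat plane_tree \<times> nat \<times> nat \<Rightarrow> nat plane_tree" where
  "insert_leaf m = (\<lambda>(T, v, i). T(v := take i (T v) @ m # drop i (T v)))"

definition delete_leaf :: "nat \<Rightarrow> nat plane_tree \<Rightarrow> nat plane_tree \<times> nat \<times> nat" where
  "delete_leaf m T = (\<lambda>v. removeAll m (T v), parent T m, length (cohort T m))"

text \<open>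
  The largest label is always a leaf, and deleting it leaves an increasing ordered tree. It can be put
  back at any position of any list of children.
\<close>

lemma bij_insert_leaf:
  "bij_betw (insert_leaf (Suc n))
     (SIGMA T:increasing_ordered_trees n. SIGMA v:{..n}. {..length (T v)})
     (increasing_ordered_trees (Suc n))"
proof (rule bij_betw_byWitness[where f' = "delete_leaf (Suc n)"])
  let ?A = "SIGMA T:increasing_ordered_trees n. SIGMA v:{..n}. {..length (T v)}"
  have ins: "insert_leaf (Suc n) (T, v, i) \<in> increasing_ordered_trees (Suc n)"
    "delete_leaf (Suc n) (insert_leaf (Suc n) (T, v, i)) = (T, v, i)"
    if T: "T \<in> increasing_ordered_trees n" and v: "v \<le> n" and i: "i \<le> length (T v)" for T v i
  proof -
    let ?S = "insert_leaf (Suc n) (T, v, i)"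
    have S: "?S = T(v := take i (T v) @ Suc n # drop i (T v))" by (simp add: insert_leaf_def)
    have new: "Suc n \<notin> set (T x)" for x using child_bounds(2)[OF T, of "Suc n" x] by auto
    have td: "set (take i (T v)) \<union> set (drop i (T v)) = set (T v)"
      by (metis append_take_drop_id set_append)
    have mem: "w \<in> set (?S x) \<longleftrightarrow> w \<in> set (T x) \<or> x = v \<and> w = Suc n" for w x
      using td unfolding S by auto
    show S_tree: "?S \<in> increasing_ordered_trees (Suc n)"
      unfolding increasing_ordered_trees_iff
    proof (intro conjI allI ballI)
      fix x
      have "set (take i (T v)) \<inter> set (drop i (T v)) = {}"
        by (rule set_take_disj_set_drop_if_distinct[OF distinct_children[OF T] order_refl])
      then have "distinct (take i (T v) @ Suc n # drop i (T v))"
        using new[of v] td distinct_children[OF T, of v] by auto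
      then show "distinct (?S x)" unfolding S using distinct_children[OF T, of x] by simp
      have "\<forall>w\<in>set (T x). x < w \<and> w \<le> Suc n" using child_bounds[OF T] le_SucI by blast
      then show "set (?S x) \<subseteq> {x<..Suc n}" using v by (auto simp: mem)
    next
      fix w assume w: "w \<in> {0<..Suc n}"
      show "\<exists>!x. w \<in> set (?S x)"
      proof (cases "w = Suc n")
        case True
        then show ?thesis by (simp add: mem new)
      next
        case False
        then have "w \<in> {0<..n}" using w by auto
        then have "\<exists>!x. w \<in> set (T x)" using T unfolding increasing_ordered_trees_iff by blast
        then show ?thesis using False by (simp add: mem)
      qed
    qed
    have "?S v = take i (T v) @ Suc n # drop i (T v)" by (simp add: S)
    then have "cohort ?S (Suc n) = take i (T v)" by (rule siblings_split(1)[OF S_tree])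
    moreover have "parent ?S (Suc n) = v" by (rule parent_eq[OF S_tree]) (simp add: mem)
    moreover have "removeAll (Suc n) (?S x) = T x" for x
    proof -
      have "Suc n \<notin> set (take i (T v))" "Suc n \<notin> set (drop i (T v))" using new[of v] td by blast+
      then show ?thesis unfolding S using new[of x] by simp
    qed
    ultimately show "delete_leaf (Suc n) ?S = (T, v, i)"
      using i by (simp add: delete_leaf_def)
  qed
  show "\<forall>a\<in>?A. delete_leaf (Suc n) (insert_leaf (Suc n) a) = a"
    "insert_leaf (Suc n) ` ?A \<subseteq> increasing_ordered_trees (Suc n)"
    using ins by auto
  have del: "delete_leaf (Suc n) S \<in> ?A" "insert_leaf (Suc n) (delete_leaf (Suc n) S) = S"
    if S: "S \<in> increasing_ordered_trees (Suc n)" for S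
  proof -
    have "has_parent S (Suc n)" using has_parent_iff[OF S] by simp
    then obtain v P Q where v: "S v = P @ Suc n # Q"
      unfolding has_parent_def by (meson split_list)
    have co: "cohort S (Suc n) = P" by (rule siblings_split(1)[OF S v])
    have pa: "parent S (Suc n) = v" by (rule parent_eq[OF S]) (simp add: v)
    let ?T = "\<lambda>x. removeAll (Suc n) (S x)"
    have "Suc n \<notin> set P" "Suc n \<notin> set Q" using distinct_children[OF S, of v] v by auto
    then have Tv: "?T v = P @ Q" unfolding v by simp
    have Tx: "?T x = S x" if "x \<noteq> v" for x
      using parent_unique[OF S, of "Suc n" x v] that v by (intro removeAll_id) auto
    have "?T \<in> increasing_ordered_trees n"
      unfolding increasing_ordered_trees_iff
    proof (intro conjI allI ballI)
      fix x
      show "distinct (?T x)" by (simp add: distinct_removeAll distinct_children[OF S])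
      have "\<forall>w\<in>set (S x). x < w \<and> w \<le> Suc n" using child_bounds[OF S] by blast
      then show "set (?T x) \<subseteq> {x<..n}" by (auto simp: le_Suc_eq)
    next
      fix w assume w: "w \<in> {0<..n}"
      then have "\<exists>!x. w \<in> set (S x)" using S unfolding increasing_ordered_trees_iff by simp
      moreover have "w \<in> set (?T x) \<longleftrightarrow> w \<in> set (S x)" for x using w by auto
      ultimately show "\<exists>!x. w \<in> set (?T x)" by simp
    qed
    moreover have "v \<le> n" using child_bounds(1)[OF S, of "Suc n" v] v by simp
    ultimately show "delete_leaf (Suc n) S \<in> ?A"
      using Tv by (simp add: delete_leaf_def co pa)
    show "insert_leaf (Suc n) (delete_leaf (Suc n) S) = S"
      unfolding delete_leaf_def insert_leaf_def co pa using Tv Tx v by (auto simp: fun_eq_iff)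
  qed
  show "\<forall>S\<in>increasing_ordered_trees (Suc n). insert_leaf (Suc n) (delete_leaf (Suc n) S) = S"
    "delete_leaf (Suc n) ` increasing_ordered_trees (Suc n) \<subseteq> ?A"
    using del(2) by (blast, intro image_subsetI del(1))
qed

lemma increasing_ordered_trees_0: "increasing_ordered_trees 0 = {\<lambda>v. []}"
  by (auto simp: increasing_ordered_trees_iff fun_eq_iff)

lemma card_increasing_ordered_trees:
  "finite (increasing_ordered_trees n) \<and> card (increasing_ordered_trees n) = double_fact (2 * n - 1)"
proof (induction n)
  case 0
  show ?case by (simp add: increasing_ordered_trees_0)
next
  case (Suc n)
  let ?I = "increasing_ordered_trees n"
  let ?A = "SIGMA T:?I. SIGMA v:{..n}. {..length (T v)}"
  \<comment> \<open>A vertex with \<open>k\<close> children offers \<open>k + 1\<close> positions, and there are \<open>n\<close> children in all.\<close>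
  have places: "card (SIGMA v:{..n}. {..length (T v)}) = 2 * n + 1" if "T \<in> ?I" for T
  proof -
    have "card (SIGMA v:{..n}. {..length (T v)}) = (\<Sum>v\<le>n. length (T v) + 1)" by simp
    also have "\<dots> = 2 * n + 1" unfolding sum.distrib sum_length_children[OF that] by simp
    finally show ?thesis .
  qed
  have "card ?A = (\<Sum>T\<in>?I. card (SIGMA v:{..n}. {..length (T v)}))"
    using Suc by (intro card_SigmaI) auto
  also have "\<dots> = (2 * n + 1) * double_fact (2 * n - 1)" using places Suc by simp
  also have "\<dots> = double_fact (2 * Suc n - 1)" by (cases n) simp_all
  finally have "card ?A = double_fact (2 * Suc n - 1)" .
  moreover have "finite ?A" using Suc by (intro finite_SigmaI) auto
  ultimately show ?case
    using bij_betw_finite[OF bij_insert_leaf[of n]] bij_betw_same_card[OF bij_insert_leaf[of n]] by simp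
qed

section \<open>The bijection\<close>

theorem mainTheorem8:
  fixes n :: nat
  assumes "n \<ge> 1"
  shows "(\<forall>(T, M) \<in> node_marked_Klazar_trees n. \<forall>us.
            distinct us \<and> set us = M \<longrightarrow> fold process us T = phi (T, M))
    \<and> bij_betw phi (node_marked_Klazar_trees n) (increasing_ordered_trees n)
    \<and> (\<forall>(T, M) \<in> node_marked_Klazar_trees n. {v. Klazar_violator (phi (T, M)) v} = M)
    \<and> card (node_marked_Klazar_trees n) = double_fact (2 * n - 1)
    \<and> (\<Sum>K\<in>Klazar_trees n. 2 ^ card (nodes K)) = double_fact (2 * n - 1)"
proof -
  let ?N = "node_marked_Klazar_trees n" and ?I = "increasing_ordered_trees n"
  have N: "T \<in> ?I" "M \<subseteq> nodes T" "\<forall>u\<in>M. \<not> Klazar_violator T u" "finite M"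
    "{w. Klazar_violator T w} = {}" if "(T, M) \<in> ?N" for T M
    using that finite_nodes finite_subset
    unfolding node_marked_Klazar_trees_def Klazar_trees_def by blast+
  have order: "fold process us T = phi (T, M)"
    if "(T, M) \<in> ?N" "distinct us" "set us = M" for T M us
    using fold_process_order[OF N(1,2,3)[OF that(1)] that(2,3), of "sorted_list_of_set M"]
      N(4)[OF that(1)] by (simp add: phi_def)
  have viol: "{v. Klazar_violator (phi (T, M)) v} = M" and tree: "phi (T, M) \<in> ?I"
    if "(T, M) \<in> ?N" for T M
    using fold_process_violators[OF N(1)[OF that], of "sorted_list_of_set M"]
      fold_process_tree[OF N(1)[OF that], of "sorted_list_of_set M"] N[OF that]
    by (simp_all add: phi_def)
  have "inj_on phi ?N"
  proof (rule inj_onI, clarify)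
    fix S A T M assume S: "(S, A) \<in> ?N" and T: "(T, M) \<in> ?N" and eq: "phi (S, A) = phi (T, M)"
    have "A = M" using viol[OF S] viol[OF T] eq by simp
    moreover have "S = T"
      using fold_process_inj[OF N(1)[OF S] N(1)[OF T], of "sorted_list_of_set M"]
        N[OF S] N[OF T] eq \<open>A = M\<close> by (simp add: phi_def)
    ultimately show "S = T \<and> A = M" by simp
  qed
  moreover have "phi ` ?N = ?I"
  proof (intro equalityI subsetI)
    fix T' assume "T' \<in> ?I"
    then obtain T us where "T \<in> Klazar_trees n" "distinct us" "set us \<subseteq> nodes T"
      and T': "fold process us T = T'" using fold_process_surj by blast
    then have "(T, set us) \<in> ?N" "phi (T, set us) = T'"
      using order[of T "set us" us] by (auto simp: node_marked_Klazar_trees_def)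
    then show "T' \<in> phi ` ?N" by force
  qed (use tree in auto)
  ultimately have bij: "bij_betw phi ?N ?I" by (simp add: bij_betw_def)
  have card: "card ?N = double_fact (2 * n - 1)"
    using bij_betw_same_card[OF bij] card_increasing_ordered_trees by simp
  have "Klazar_trees n \<subseteq> ?I" by (auto simp: Klazar_trees_def)
  then have fin: "finite (Klazar_trees n)" "\<forall>K\<in>Klazar_trees n. finite (nodes K)"
    using card_increasing_ordered_trees finite_nodes by (blast intro: finite_subset)+
  have "?N = (SIGMA K:Klazar_trees n. Pow (nodes K))"
    by (auto simp: node_marked_Klazar_trees_def)
  then have "card ?N = (\<Sum>K\<in>Klazar_trees n. card (Pow (nodes K)))"
    using fin by (simp add: card_SigmaI)
  also have "\<dots> = (\<Sum>K\<in>Klazar_trees n. 2 ^ card (nodes K))"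
    using fin(2) by (intro sum.cong) (auto simp: card_Pow)
  finally have "(\<Sum>K\<in>Klazar_trees n. 2 ^ card (nodes K)) = double_fact (2 * n - 1)"
    using card by simp
  then show ?thesis using order bij viol card by blast
qed

end
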